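(* Let $a<b$ be real numbers. There exists a bounded Lebesgue integrable exponent $p:[a,b]\to[1,+\infty)$ for which $WBV_{p(\cdot)}[a,b]\setminus BV^{p(\cdot)}[a,b]\neq\emptyset$.
   Context: For a nondegenerate closed interval $Q=[s,t]\subset[a,b]$ put $f(Q):=f(t)-f(s)$, $|Q|=t-s$, and $\bar p(Q):=\left(\frac{1}{|Q|}\int_Q\frac{1}{p(x)}\,dx\right)^{-1}$. A finite partition of $[a,b]$ is a family $P=\{Q_k\}_{k=1}^n$ with $Q_k=[t_{k-1},t_k]$ and $a=t_0<\dots<t_n=b$; $\Pi[a,b]$ is the set of all finite partitions. Define $$V_a^b(p,f):=\sup_{P\in\Pi[a,b]}\sum_{k=1}^n|f(Q_k)|^{\bar p(Q_k)}\in[0,+\infty],$$ $$\|f\|_{WBV_{p(\cdot)}}:=\inf\{\lambda>0: V_a^b(p,f/\lambda)\le 1\}\quad(\inf\emptyset=+\infty),$$ $$WBV_{p(\cdot)}[a,b]:=\{f:[a,b]\to\mathbb{R}: f(a)=0,\ \|f\|_{WBV_{p(\cdot)}}<+\infty\}.$$ A tagged partition of $[a,b]$ is a finite partition $\{Q_k\}_{k=1}^n$ together with points $x_k\in[t_{k-1},t_k]$, $k=1,\dots,n$; $\Pi^*[a,b]$ is the set of all tagged partitions. For bounded $p$ define $$V^{p(\cdot)}_{[a,b]}(f):=\sup_{\Pi^*[a,b]}\sum_{k=1}^n|f(Q_k)|^{p(x_k)},\qquad \|f\|_{BV^{p(\cdot)}}:=\inf\{\lambda>0: V^{p(\cdot)}_{[a,b]}(f/\lambda)\le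 1\},$$ $$BV^{p(\cdot)}[a,b]:=\{f:[a,b]\to\mathbb{R}: f(a)=0,\ \|f\|_{BV^{p(\cdot)}}<+\infty\}.$$ *)

theory Defs
  imports "HOL-Analysis.Analysis"
begin

(* The partition with nodes a = t 0 < ... < t n = b; its intervals are [t k, t (Suc k)] for k < n.
   Values of t beyond n are irrelevant. *)
definition finite_partition :: "real \<Rightarrow> real \<Rightarrow> nat \<Rightarrow> (nat \<Rightarrow> real) \<Rightarrow> bool" where
  "finite_partition a b n t \<longleftrightarrow> t 0 = a \<and> t n = b \<and> (\<forall>k<n. t k < t (Suc k))"

definition tagged_partition ::
    "real \<Rightarrow> real \<Rightarrow> nat \<Rightarrow> (nat \<Rightarrow> real) \<Rightarrow> (nat \<Rightarrow> real) \<Rightarrow> bool" where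
  "tagged_partition a b n t x \<longleftrightarrow>
     finite_partition a b n t \<and> (\<forall>k<n. x k \<in> {t k..t (Suc k)})"

definition harmonic_exponent :: "(real \<Rightarrow> real) \<Rightarrow> real \<Rightarrow> real \<Rightarrow> real" where
  "harmonic_exponent p s t =
     inverse (1 / (t - s) * set_lebesgue_integral lebesgue {s..t} (\<lambda>x. 1 / p x))"

(* In both variations the exponents are positive when p \<ge> 1, so 0 powr _ = 0 is
   the usual value of the power. *)
definition WBV_variation ::
    "real \<Rightarrow> real \<Rightarrow> (real \<Rightarrow> real) \<Rightarrow> (real \<Rightarrow> real) \<Rightarrow> ennreal" where
  "WBV_variation a b p f =
     (SUP (n, t) \<in> {(n, t). finite_partition a b n t}.
        ennreal (\<Sum>k<n. \<bar>f (t (Suc k)) - f (t k)\<bar> powr harmonic_exponent p (t k) (t (Suc k))))"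

(* The infimum is taken in [0, \<infinity>], where Inf {} = \<infinity>. *)
definition WBV_norm ::
    "real \<Rightarrow> real \<Rightarrow> (real \<Rightarrow> real) \<Rightarrow> (real \<Rightarrow> real) \<Rightarrow> ennreal" where
  "WBV_norm a b p f =
     (INF l \<in> {l::real. l > 0 \<and> WBV_variation a b p (\<lambda>x. f x / l) \<le> 1}. ennreal l)"

(* A real function on [a, b] is represented by its extension that is undefined
   (the library's extensional functions) outside [a, b]. *)
definition WBV :: "real \<Rightarrow> real \<Rightarrow> (real \<Rightarrow> real) \<Rightarrow> (real \<Rightarrow> real) set" where
  "WBV a b p = {f \<in> extensional {a..b}. f a = 0 \<and> WBV_norm a b p f < \<infinity>}"

definition BV_variation ::
    "real \<Rightarrow> real \<Rightarrow> (real \<Rightarrow> real) \<Rightarrow> (real \<Rightarrow> real) \<Rightarrow> ennreal" where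
  "BV_variation a b p f =
     (SUP (n, t, x) \<in> {(n, t, x). tagged_partition a b n t x}.
        ennreal (\<Sum>k<n. \<bar>f (t (Suc k)) - f (t k)\<bar> powr p (x k)))"

definition BV_norm ::
    "real \<Rightarrow> real \<Rightarrow> (real \<Rightarrow> real) \<Rightarrow> (real \<Rightarrow> real) \<Rightarrow> ennreal" where
  "BV_norm a b p f =
     (INF l \<in> {l::real. l > 0 \<and> BV_variation a b p (\<lambda>x. f x / l) \<le> 1}. ennreal l)"

definition BV :: "real \<Rightarrow> real \<Rightarrow> (real \<Rightarrow> real) \<Rightarrow> (real \<Rightarrow> real) set" where
  "BV a b p = {f \<in> extensional {a..b}. f a = 0 \<and> BV_norm a b p f < \<infinity>}"

end

theory Submission
  imports Defs
begin

text \<open>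
  The averaged exponent of an interval only sees the class of \<open>p\<close> modulo null sets, whereas the
  tags of a tagged partition may be placed at exceptional points.  So let \<open>p = 2\<close> except on a
  countable set \<open>D\<close>, where \<open>p = 1\<close>.  Every averaged exponent is then \<open>2\<close>, and membership in
  \<open>WBV\<close> is finiteness of the quadratic variation; but if the nodes are taken in \<open>D\<close> and used as
  tags, membership in \<open>BV\<close> forces the ordinary variation over these nodes to be bounded.

  Let \<open>D\<close> consist of the points \<open>c n = a + (b - a) / (n + 1)\<close>, which decrease from \<open>b\<close> to \<open>a\<close>,
  and let \<open>f\<close> have the value \<open>(-1)\<^sup>n / (n + 1)\<close> at \<open>c n\<close> and vanish elsewhere.  The quadratic
  variation of \<open>f\<close> is at most four times \<open>\<Sum>n. 1 / (n + 1)\<^sup>2\<close>, because a squared increment is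
  bounded by twice the sum of the two squared values
  (\<open>sum_squared_increments_le\<close>, \<open>sum_squares_spike_le\<close>).  Along the nodes \<open>c n\<close> the signs
  alternate, so nothing cancels in the increments and the ordinary variation dominates the
  divergent harmonic series (\<open>BV_variation_alternating\<close>).
\<close>

section \<open>An exponent that differs from a constant on a countable set\<close>

definition two_valued_exponent :: "real set \<Rightarrow> real \<Rightarrow> real" where
  "two_valued_exponent D x = (if x \<in> D then 1 else 2)"

lemma two_valued_exponent_measurable:
  assumes "countable D"
  shows "two_valued_exponent D \<in> borel_measurable lebesgue"
proof -
  have "D \<in> sets borel"
    using assms by (rule sets.countable[rotated]) auto
  then have "two_valued_exponent D \<in> borel_measurable borel"
    unfolding two_valued_exponent_def by measurable
  then show ?thesis
    by (simp add: measurable_completion)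
qed

lemma AE_two_valued_exponent:
  assumes "countable D"
  shows "AE x in lebesgue. two_valued_exponent D x = 2"
proof (rule AE_I')
  show "D \<in> null_sets lebesgue"
    using assms by (simp add: countable_imp_null_set_lborel null_sets_completionI)
qed (auto simp: two_valued_exponent_def)

lemma set_integrable_two_valued_exponent:
  assumes "countable D"
  shows "set_integrable lebesgue {a..b} (two_valued_exponent D)"
proof -
  have "set_integrable lebesgue {a..b} (\<lambda>x. 2 :: real)"
    by (rule absolutely_integrable_on_const) simp
  moreover have "AE x in lebesgue. x \<in> {a..b} \<longrightarrow> two_valued_exponent D x = 2"
    using AE_two_valued_exponent[OF assms] by eventually_elim auto
  ultimately show ?thesis
    using two_valued_exponent_measurable[OF assms]
    by (subst set_integrable_cong_AE[where g = "\<lambda>_. 2"]) auto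
qed

lemma harmonic_exponent_two_valued_exponent:
  assumes "countable D" and "s < t"
  shows "harmonic_exponent (two_valued_exponent D) s t = 2"
proof -
  have "set_lebesgue_integral lebesgue {s..t} (\<lambda>x. 1 / two_valued_exponent D x)
      = set_lebesgue_integral lebesgue {s..t} (\<lambda>x. 1 / 2)"
    using AE_two_valued_exponent[OF assms(1)] two_valued_exponent_measurable[OF assms(1)]
    by (intro set_lebesgue_integral_cong_AE) (auto elim: eventually_mono)
  also have "\<dots> = (t - s) / 2"
    using assms(2) by (simp add: set_lebesgue_integral_def)
  finally have "set_lebesgue_integral lebesgue {s..t} (\<lambda>x. 1 / two_valued_exponent D x)
      = (t - s) / 2" .
  then show ?thesis
    using assms(2) unfolding harmonic_exponent_def by (simp only:) simp
qed

section \<open>Quadratic variation of a function with countable support\<close>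

definition spike_function :: "(nat \<Rightarrow> real) \<Rightarrow> (nat \<Rightarrow> real) \<Rightarrow> real \<Rightarrow> real" where
  "spike_function c g x = (if x \<in> range c then g (inv c x) else 0)"

lemma spike_function_at:
  assumes "inj c"
  shows "spike_function c g (c n) = g n"
  using assms by (simp add: spike_function_def)

text \<open>Distinct points receive distinct terms of the series.\<close>

lemma sum_squares_spike_le:
  assumes "inj c" and "finite T" and "summable (\<lambda>n. (g n)\<^sup>2)"
  shows "(\<Sum>x\<in>T. (spike_function c g x)\<^sup>2) \<le> (\<Sum>n. (g n)\<^sup>2)"
proof -
  let ?M = "inv c ` (T \<inter> range c)"
  have "(\<Sum>x\<in>T. (spike_function c g x)\<^sup>2) = (\<Sum>x\<in>T \<inter> range c. (g (inv c x))\<^sup>2)"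
    using assms(2) by (intro sum.mono_neutral_cong_right) (auto simp: spike_function_def)
  also have "\<dots> = (\<Sum>n\<in>?M. (g n)\<^sup>2)"
    by (subst sum.reindex) (auto intro!: inj_on_subset[OF inj_on_inv_into[of _ c UNIV]])
  also have "\<dots> \<le> (\<Sum>n. (g n)\<^sup>2)"
    using assms by (intro sum_le_suminf) auto
  finally show ?thesis .
qed

text \<open>
  By \<open>(u - v)\<^sup>2 \<le> 2 u\<^sup>2 + 2 v\<^sup>2\<close>, the left ends and the right ends of the intervals each
  contribute at most \<open>2 * S\<close>.
\<close>

lemma sum_squared_increments_le:
  fixes f t :: "_ \<Rightarrow> real"
  assumes inj: "inj_on t {..n::nat}"
    and bound: "\<And>T. finite T \<Longrightarrow> T \<subseteq> t ` {..n} \<Longrightarrow> (\<Sum>x\<in>T. (f x)\<^sup>2) \<le> S"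
  shows "(\<Sum>k<n. (f (t (Suc k)) - f (t k))\<^sup>2) \<le> 4 * S"
proof -
  have "(\<Sum>k<n. (f (t (Suc k)) - f (t k))\<^sup>2)
      \<le> (\<Sum>k<n. 2 * (f (t (Suc k)))\<^sup>2 + 2 * (f (t k))\<^sup>2)"
  proof (rule sum_mono)
    fix k
    have "0 \<le> (f (t (Suc k)) + f (t k))\<^sup>2" by simp
    then show "(f (t (Suc k)) - f (t k))\<^sup>2 \<le> 2 * (f (t (Suc k)))\<^sup>2 + 2 * (f (t k))\<^sup>2"
      by (simp add: power2_eq_square algebra_simps)
  qed
  also have "\<dots> = 2 * (\<Sum>k<n. (f (t (Suc k)))\<^sup>2) + 2 * (\<Sum>k<n. (f (t k))\<^sup>2)"
    by (simp add: sum.distrib sum_distrib_left)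
  also have "(\<Sum>k<n. (f (t (Suc k)))\<^sup>2) = (\<Sum>x\<in>t ` Suc ` {..<n}. (f x)\<^sup>2)"
  proof -
    have "inj_on t (Suc ` {..<n})"
      using inj by (rule inj_on_subset) auto
    then show ?thesis by (simp add: sum.reindex)
  qed
  also have "\<dots> \<le> S" by (rule bound) auto
  also have "(\<Sum>k<n. (f (t k))\<^sup>2) = (\<Sum>x\<in>t ` {..<n}. (f x)\<^sup>2)"
  proof -
    have "inj_on t {..<n}"
      using inj by (rule inj_on_subset) auto
    then show ?thesis by (simp add: sum.reindex)
  qed
  also have "\<dots> \<le> S" by (rule bound) auto
  finally show ?thesis by simp
qed

lemma finite_partition_less:
  assumes "finite_partition a b n t" and "i < j" and "j \<le> n"
  shows "t i < t j"
  using assms(2,3)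
proof (induction j)
  case (Suc j)
  then have "t j < t (Suc j)"
    using assms(1) by (auto simp: finite_partition_def)
  with Suc show ?case
    by (cases "i = j") auto
qed simp

lemma finite_partition_inj_on:
  assumes "finite_partition a b n t"
  shows "inj_on t {..n}"
proof (rule inj_onI)
  fix i j assume "i \<in> {..n}" "j \<in> {..n}" "t i = t j"
  then show "i = j"
    using finite_partition_less[OF assms, of i j] finite_partition_less[OF assms, of j i]
    by (cases i j rule: linorder_cases) auto
qed

lemma finite_partition_subset:
  assumes "finite_partition a b n t"
  shows "t ` {..n} \<subseteq> {a..b}"
proof (clarsimp, intro conjI)
  fix k assume "k \<le> n"
  then show "a \<le> t k"
    using finite_partition_less[OF assms, of 0 k] assms
    by (cases "k = 0") (auto simp: finite_partition_def)
  show "t k \<le> b"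
    using finite_partition_less[OF assms, of k n] assms \<open>k \<le> n\<close>
    by (cases "k = n") (auto simp: finite_partition_def)
qed

lemma WBV_variation_spike_le:
  assumes "countable D" and "inj c" and summable: "summable (\<lambda>n. (g n)\<^sup>2)" and "l > 0"
  shows "WBV_variation a b (two_valued_exponent D)
           (\<lambda>x. restrict (spike_function c g) {a..b} x / l)
         \<le> ennreal (4 * (\<Sum>n. (g n)\<^sup>2) / l\<^sup>2)"
  unfolding WBV_variation_def
proof (rule SUP_least, clarify)
  fix n t assume part: "finite_partition a b n t"
  let ?f = "restrict (spike_function c g) {a..b}"
  have "(\<Sum>k<n. \<bar>?f (t (Suc k)) / l - ?f (t k) / l\<bar>
             powr harmonic_exponent (two_valued_exponent D) (t k) (t (Suc k)))
      = (\<Sum>k<n. (?f (t (Suc k)) - ?f (t k))\<^sup>2) / l\<^sup>2"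
    unfolding sum_divide_distrib
  proof (rule sum.cong)
    fix k assume "k \<in> {..<n}"
    then have "harmonic_exponent (two_valued_exponent D) (t k) (t (Suc k)) = 2"
      using part assms(1)
      by (intro harmonic_exponent_two_valued_exponent) (auto simp: finite_partition_def)
    then show "\<bar>?f (t (Suc k)) / l - ?f (t k) / l\<bar>
             powr harmonic_exponent (two_valued_exponent D) (t k) (t (Suc k))
           = (?f (t (Suc k)) - ?f (t k))\<^sup>2 / l\<^sup>2"
      by (simp add: diff_divide_distrib[symmetric] power_divide)
  qed simp
  also have "\<dots> \<le> 4 * (\<Sum>n. (g n)\<^sup>2) / l\<^sup>2"
  proof (rule divide_right_mono)
    show "(\<Sum>k<n. (?f (t (Suc k)) - ?f (t k))\<^sup>2) \<le> 4 * (\<Sum>n. (g n)\<^sup>2)"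
    proof (rule sum_squared_increments_le[OF finite_partition_inj_on[OF part]])
      fix T assume T: "finite T" "T \<subseteq> t ` {..n}"
      then have "T \<subseteq> {a..b}"
        using finite_partition_subset[OF part] by blast
      then have "(\<Sum>x\<in>T. (?f x)\<^sup>2) = (\<Sum>x\<in>T. (spike_function c g x)\<^sup>2)"
        by (intro sum.cong) (auto simp: subset_iff)
      then show "(\<Sum>x\<in>T. (?f x)\<^sup>2) \<le> (\<Sum>n. (g n)\<^sup>2)"
        using sum_squares_spike_le[OF assms(2) T(1) summable] by simp
    qed
  qed simp
  finally show "ennreal (\<Sum>k<n. \<bar>?f (t (Suc k)) / l - ?f (t k) / l\<bar>
             powr harmonic_exponent (two_valued_exponent D) (t k) (t (Suc k)))
        \<le> ennreal (4 * (\<Sum>n. (g n)\<^sup>2) / l\<^sup>2)"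
    by (rule ennreal_leI)
qed

lemma spike_in_WBV:
  assumes "countable D" and "inj c" and summable: "summable (\<lambda>n. (g n)\<^sup>2)"
    and "a \<le> b" and "a \<notin> range c"
  shows "restrict (spike_function c g) {a..b} \<in> WBV a b (two_valued_exponent D)"
proof -
  let ?f = "restrict (spike_function c g) {a..b}"
  let ?S = "\<Sum>n. (g n)\<^sup>2"
  \<comment> \<open>The summand \<open>1\<close> keeps \<open>l\<close> positive when \<open>g\<close> vanishes identically.\<close>
  define l where "l = 2 * sqrt (?S + 1)"
  have S: "?S \<ge> 0" using summable by (intro suminf_nonneg) auto
  then have l: "l > 0" "l\<^sup>2 = 4 * (?S + 1)"
    by (simp_all add: l_def power_mult_distrib)
  have "WBV_variation a b (two_valued_exponent D) (\<lambda>x. ?f x / l) \<le> ennreal (4 * ?S / l\<^sup>2)"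
    using assms l by (intro WBV_variation_spike_le) auto
  also have "\<dots> \<le> ennreal 1"
    using S unfolding l(2) by (intro ennreal_leI) (simp add: divide_simps)
  finally have "WBV_norm a b (two_valued_exponent D) ?f \<le> ennreal l"
    unfolding WBV_norm_def using l(1) by (intro INF_lower) auto
  then have "WBV_norm a b (two_valued_exponent D) ?f < \<infinity>"
    by (rule le_less_trans) simp
  then show ?thesis
    using assms by (auto simp: WBV_def spike_function_def)
qed

section \<open>Ordinary variation along the exceptional points\<close>

definition harmonic_point :: "real \<Rightarrow> real \<Rightarrow> nat \<Rightarrow> real" where
  "harmonic_point a b n = a + (b - a) / real (Suc n)"

definition alternating_harmonic :: "nat \<Rightarrow> real" where
  "alternating_harmonic n = (-1) ^ n / real (Suc n)"

lemma harmonic_point_decreasing: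
  assumes "a < b"
  shows "harmonic_point a b (Suc n) < harmonic_point a b n"
  using assms unfolding harmonic_point_def by (simp add: divide_strict_left_mono)

lemma inj_harmonic_point:
  assumes "a < b"
  shows "inj (harmonic_point a b)"
proof (rule injI)
  fix m n assume "harmonic_point a b m = harmonic_point a b n"
  then show "m = n"
    using assms by (simp add: harmonic_point_def)
qed

lemma harmonic_point_gt:
  assumes "a < b"
  shows "a < harmonic_point a b n"
  using assms by (simp add: harmonic_point_def)

lemma harmonic_point_le:
  assumes "a < b"
  shows "harmonic_point a b n \<le> b"
proof -
  have "(b - a) / real (Suc n) \<le> (b - a) / 1"
    using assms by (intro divide_left_mono) auto
  then show ?thesis by (simp add: harmonic_point_def)
qed

lemma summable_alternating_harmonic_squared: "summable (\<lambda>n. (alternating_harmonic n)\<^sup>2)"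
proof -
  have "summable (\<lambda>n. inverse (real (Suc n) ^ 2))"
    by (subst summable_Suc_iff) (rule inverse_power_summable, simp)
  moreover have "(alternating_harmonic n)\<^sup>2 = inverse (real (Suc n) ^ 2)" for n
  proof -
    have "((- 1 :: real) ^ n)\<^sup>2 = 1"
      by (simp add: power_mult[symmetric])
    then show ?thesis
      unfolding alternating_harmonic_def
      by (simp only: power_divide) (simp add: divide_inverse)
  qed
  ultimately show ?thesis by presburger
qed

lemma alternating_harmonic_increment:
  "1 / real (Suc n) \<le> \<bar>alternating_harmonic n - alternating_harmonic (Suc n)\<bar>"
proof -
  have "alternating_harmonic n - alternating_harmonic (Suc n)
      = (-1) ^ n * (1 / real (Suc n) + 1 / real (Suc (Suc n)))"
    unfolding alternating_harmonic_def by (simp add: algebra_simps)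
  then show ?thesis
    by (simp add: abs_mult power_abs)
qed

text \<open>
  The nodes are \<open>a\<close> followed by the harmonic points of index \<open>N, \<dots>, 0\<close>, and each interval is
  tagged by its right end, where the exponent is \<open>1\<close>.
\<close>

lemma BV_variation_alternating:
  fixes a b l :: real and N :: nat
  assumes "a < b" and "l > 0"
  defines "c \<equiv> harmonic_point a b"
  shows "ennreal (harm (Suc N) / l)
       \<le> BV_variation a b (two_valued_exponent (range c))
           (\<lambda>x. restrict (spike_function c alternating_harmonic) {a..b} x / l)"
proof -
  let ?f = "restrict (spike_function c alternating_harmonic) {a..b}"
  let ?p = "two_valued_exponent (range c)"
  define t where "t k = (if k = 0 then a else c (Suc N - k))" for k
  have at: "?f (c n) = alternating_harmonic n" for n
    using assms(1) harmonic_point_gt[of a b n] harmonic_point_le[of a b n]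
    by (simp add: spike_function_at inj_harmonic_point c_def less_imp_le)
  have "a \<notin> range c"
    using harmonic_point_gt[OF assms(1)] by (auto simp: c_def) (metis less_irrefl)
  then have at_a: "?f a = 0"
    using assms(1) by (simp add: spike_function_def)
  have increasing: "t k < t (Suc k)" if "k < Suc N" for k
  proof (cases "k = 0")
    case True
    then show ?thesis using harmonic_point_gt[OF assms(1)] by (simp add: t_def c_def)
  next
    case False
    then have "Suc N - k = Suc (N - k)" using that by simp
    then show ?thesis
      using False harmonic_point_decreasing[OF assms(1)] by (simp add: t_def c_def)
  qed
  have "tagged_partition a b (Suc N) t (\<lambda>k. t (Suc k))"
  proof -
    have "t 0 = a" "t (Suc N) = b"
      by (simp_all add: t_def c_def harmonic_point_def)
    then show ?thesis
      using increasing
      by (auto simp: tagged_partition_def finite_partition_def intro: less_imp_le)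
  qed
  then have "ennreal (\<Sum>k<Suc N. \<bar>?f (t (Suc k)) / l - ?f (t k) / l\<bar> powr ?p (t (Suc k)))
      \<le> BV_variation a b ?p (\<lambda>x. ?f x / l)"
    unfolding BV_variation_def
    by (intro SUP_upper2[where i = "(Suc N, t, \<lambda>k. t (Suc k))"]) auto
  moreover have "harm (Suc N) / l
      \<le> (\<Sum>k<Suc N. \<bar>?f (t (Suc k)) / l - ?f (t k) / l\<bar> powr ?p (t (Suc k)))"
  proof -
    have "harm (Suc N) = (\<Sum>k<Suc N. 1 / real (Suc k))"
      unfolding harm_def
      by (rule sum.reindex_bij_witness[of _ Suc "\<lambda>k. k - 1"]) (auto simp: divide_inverse)
    also have "\<dots> = (\<Sum>k<Suc N. 1 / real (Suc (N - k)))"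
      by (subst sum.nat_diff_reindex[symmetric]) simp
    finally have "harm (Suc N) / l = (\<Sum>k<Suc N. 1 / real (Suc (N - k)) / l)"
      by (simp only: sum_divide_distrib)
    also have "\<dots> \<le> (\<Sum>k<Suc N. \<bar>?f (t (Suc k)) / l - ?f (t k) / l\<bar> powr ?p (t (Suc k)))"
    proof (rule sum_mono)
      fix k assume k: "k \<in> {..<Suc N}"
      have "1 / real (Suc (N - k)) \<le> \<bar>?f (t (Suc k)) - ?f (t k)\<bar>"
      proof (cases "k = 0")
        case True
        have "?f (t (Suc 0)) - ?f (t 0) = alternating_harmonic N"
          by (simp add: t_def at at_a del: restrict_apply)
        then show ?thesis
          using True by (simp add: alternating_harmonic_def abs_divide power_abs del: restrict_apply)
      next
        case False
        then have "Suc N - k = Suc (N - k)" using k by simp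
        then have "?f (t (Suc k)) - ?f (t k)
            = alternating_harmonic (N - k) - alternating_harmonic (Suc (N - k))"
          using False by (simp add: t_def at del: restrict_apply)
        then show ?thesis
          using alternating_harmonic_increment[of "N - k"] by simp
      qed
      then have "1 / real (Suc (N - k)) / l \<le> \<bar>?f (t (Suc k)) / l - ?f (t k) / l\<bar>"
        using assms(2) divide_right_mono[of _ _ l]
        by (simp only: diff_divide_distrib[symmetric] abs_divide abs_of_pos less_imp_le)
      moreover have "?p (t (Suc k)) = 1"
        by (simp add: two_valued_exponent_def t_def)
      ultimately show "1 / real (Suc (N - k)) / l
          \<le> \<bar>?f (t (Suc k)) / l - ?f (t k) / l\<bar> powr ?p (t (Suc k))"
        by (simp del: restrict_apply)
    qed
    finally show ?thesis .
  qed
  ultimately show ?thesis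
    by (meson ennreal_leI order_trans)
qed

lemma alternating_not_in_BV:
  assumes "a < b"
  defines "c \<equiv> harmonic_point a b"
  shows "restrict (spike_function c alternating_harmonic) {a..b}
       \<notin> BV a b (two_valued_exponent (range c))"
proof -
  let ?f = "restrict (spike_function c alternating_harmonic) {a..b}"
  let ?p = "two_valued_exponent (range c)"
  have "\<not> BV_variation a b ?p (\<lambda>x. ?f x / l) \<le> 1" if "l > 0" for l
  proof
    assume le: "BV_variation a b ?p (\<lambda>x. ?f x / l) \<le> 1"
    have "harm (Suc N) \<le> l" for N
    proof -
      have "ennreal (harm (Suc N) / l) \<le> ennreal 1"
        using order_trans[OF BV_variation_alternating[OF assms(1) that, of N, folded c_def] le]
        by simp
      then show ?thesis
        using that by (subst (asm) ennreal_le_iff) (auto simp: divide_simps)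
    qed
    then have "Bseq (\<lambda>N. harm (Suc N) :: real)"
      by (intro BseqI'[where K = l]) (simp add: harm_nonneg)
    then have "Bseq (harm :: nat \<Rightarrow> real)"
      by (simp add: Bseq_Suc_iff)
    then have "convergent (harm :: nat \<Rightarrow> real)"
      by (intro Bseq_monoseq_convergent monoI1) (auto intro: harm_mono)
    then show False
      using not_convergent_harm by blast
  qed
  then have "{l. l > 0 \<and> BV_variation a b ?p (\<lambda>x. ?f x / l) \<le> 1} = {}"
    by blast
  then have "BV_norm a b ?p ?f = \<infinity>"
    unfolding BV_norm_def by (simp only:) simp
  then show ?thesis
    by (simp add: BV_def)
qed

section \<open>The inclusion fails\<close>

theorem theorem2p5:
  fixes a b :: real
  assumes "a < b"
  shows "\<exists>p :: real \<Rightarrow> real.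
           (\<forall>x\<in>{a..b}. 1 \<le> p x) \<and> bounded (p ` {a..b}) \<and>
           set_integrable lebesgue {a..b} p \<and>
           WBV a b p - BV a b p \<noteq> {}"
proof -
  define c where "c = harmonic_point a b"
  let ?p = "two_valued_exponent (range c)"
  let ?f = "restrict (spike_function c alternating_harmonic) {a..b}"
  have "a \<notin> range c"
    using harmonic_point_gt[OF assms] by (auto simp: c_def) (metis less_irrefl)
  then have "?f \<in> WBV a b ?p"
    using assms inj_harmonic_point[OF assms] summable_alternating_harmonic_squared
    by (intro spike_in_WBV) (auto simp: c_def)
  moreover have "?f \<notin> BV a b ?p"
    using alternating_not_in_BV[OF assms] by (simp add: c_def)
  moreover have "bounded (?p ` {a..b})"
    by (rule boundedI[of _ 2]) (auto simp: two_valued_exponent_def)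
  moreover have "set_integrable lebesgue {a..b} ?p"
    by (rule set_integrable_two_valued_exponent) simp
  moreover have "\<forall>x\<in>{a..b}. 1 \<le> ?p x"
    by (simp add: two_valued_exponent_def)
  ultimately show ?thesis
    by blast
qed

end
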